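(* Let $(G,+)$ be an abelian group, let $\varphi_1,\psi_1,\varphi_2,\psi_2\in\mathrm{Aut}(G,+)$, and let $c_1,c_2\in G$. Then the following statements are equivalent: (i) the central quasigroups $\mathcal Q(G,+,\varphi_1,\psi_1,c_1)$ and $\mathcal Q(G,+,\varphi_2,\psi_2,c_2)$ are isomorphic; (ii) there is an automorphism $\gamma$ of $(G,+)$ and an element $u\in\mathrm{Im}(1-\varphi_1-\psi_1)$ such that $$\varphi_2=\gamma\varphi_1\gamma^{-1},\quad \psi_2=\gamma\psi_1\gamma^{-1},\quad c_2=\gamma(c_1+u).$$
   Context: For an abelian group $(G,+)$, automorphisms $\varphi,\psi$ of $(G,+)$ and $c\in G$, $\mathcal Q(G,+,\varphi,\psi,c)$ denotes the quasigroup $(G,* )$ with operation $x*y=\varphi(x)+\psi(y)+c$. Such quasigroups are called affine over $(G,+)$; quasigroups affine over an abelian group are called central quasigroups. The map $1-\varphi-\psi$ is the endomorphism $x\mapsto x-\varphi(x)-\psi(x)$ of $(G,+)$, and $\mathrm{Im}(1-\varphi-\psi)$ is its image. Two quasigroups are isomorphic if there is a bijection between them preserving the binary operation. *)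

theory Defs
  imports "HOL-Algebra.Bij"
begin

text \<open>
  An abelian group (G,+) is a HOL-Algebra \<^locale>\<open>comm_group\<close>, whose operation is
  written multiplicatively. Automorphisms are the elements of \<^term>\<open>auto G\<close>: bijective
  homomorphisms on the carrier that are \<^const>\<open>undefined\<close> outside it, so that equality of
  automorphisms is equality of HOL functions.
\<close>

record 'a binar = "'a partial_object" +
  bop :: "['a, 'a] \<Rightarrow> 'a" (infixl "\<star>\<index>" 70)

definition quasigroup :: "('a, 'b) binar_scheme \<Rightarrow> bool" where
  "quasigroup Q \<longleftrightarrow>
     (\<forall>x \<in> carrier Q. \<forall>y \<in> carrier Q. x \<star>\<^bsub>Q\<^esub> y \<in> carrier Q) \<and>
     (\<forall>a \<in> carrier Q. \<forall>b \<in> carrier Q. \<exists>!x. x \<in> carrier Q \<and> a \<star>\<^bsub>Q\<^esub> x = b) \<and>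
     (\<forall>a \<in> carrier Q. \<forall>b \<in> carrier Q. \<exists>!y. y \<in> carrier Q \<and> y \<star>\<^bsub>Q\<^esub> a = b)"

definition quasigroup_iso :: "('a, 'c) binar_scheme \<Rightarrow> ('b, 'd) binar_scheme \<Rightarrow> ('a \<Rightarrow> 'b) set" where
  "quasigroup_iso P Q =
     {f. bij_betw f (carrier P) (carrier Q) \<and>
         (\<forall>x \<in> carrier P. \<forall>y \<in> carrier P. f (x \<star>\<^bsub>P\<^esub> y) = f x \<star>\<^bsub>Q\<^esub> f y)}"

definition isomorphic_quasigroups :: "('a, 'c) binar_scheme \<Rightarrow> ('b, 'd) binar_scheme \<Rightarrow> bool" where
  "isomorphic_quasigroups P Q \<longleftrightarrow> quasigroup_iso P Q \<noteq> {}"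

definition affine_quasigroup ::
    "('a, 'b) monoid_scheme \<Rightarrow> ('a \<Rightarrow> 'a) \<Rightarrow> ('a \<Rightarrow> 'a) \<Rightarrow> 'a \<Rightarrow> 'a binar" where
  "affine_quasigroup G \<phi> \<psi> c =
     \<lparr>carrier = carrier G, bop = (\<lambda>x y. \<phi> x \<otimes>\<^bsub>G\<^esub> \<psi> y \<otimes>\<^bsub>G\<^esub> c)\<rparr>"

text \<open>The endomorphism \<open>1 - \<phi> - \<psi>\<close>, in multiplicative notation.\<close>

definition one_minus_minus ::
    "('a, 'b) monoid_scheme \<Rightarrow> ('a \<Rightarrow> 'a) \<Rightarrow> ('a \<Rightarrow> 'a) \<Rightarrow> 'a \<Rightarrow> 'a" where
  "one_minus_minus G \<phi> \<psi> = (\<lambda>x \<in> carrier G. x \<otimes>\<^bsub>G\<^esub> inv\<^bsub>G\<^esub> (\<phi> x) \<otimes>\<^bsub>G\<^esub> inv\<^bsub>G\<^esub> (\<psi> x))"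

lemma auto_bij_betw: "\<phi> \<in> auto G \<Longrightarrow> bij_betw \<phi> (carrier G) (carrier G)"
  by (simp add: auto_def Bij_def)

lemma (in comm_group) quasigroup_affine_quasigroup:
  assumes "\<phi> \<in> auto G" "\<psi> \<in> auto G" "c \<in> carrier G"
  shows "quasigroup (affine_quasigroup G \<phi> \<psi> c)"
proof -
  have b: "bij_betw \<phi> (carrier G) (carrier G)" "bij_betw \<psi> (carrier G) (carrier G)"
    by (rule auto_bij_betw assms)+
  have cl: "\<phi> x \<in> carrier G" "\<psi> x \<in> carrier G" if "x \<in> carrier G" for x
    using b that by (blast dest: bij_betwE)+
  have ex1: "\<exists>!x. x \<in> carrier G \<and> f x = b"
    if f: "bij_betw f (carrier G) (carrier G)" "b \<in> carrier G" for f b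
  proof -
    obtain x where x: "x \<in> carrier G" "f x = b"
      using f by (metis bij_betw_imp_surj_on imageE)
    show ?thesis
      by (rule ex1I[of _ x]) (use x f(1) in \<open>auto dest: bij_betw_imp_inj_on inj_onD\<close>)
  qed
  have right: "(\<phi> a \<otimes> \<psi> x \<otimes> c = b) = (\<psi> x = inv (\<phi> a) \<otimes> (b \<otimes> inv c))"
    if ab: "a \<in> carrier G" "b \<in> carrier G" "x \<in> carrier G" for a b x
  proof -
    have "(\<phi> a \<otimes> \<psi> x \<otimes> c = b) = (b = \<phi> a \<otimes> \<psi> x \<otimes> c)"
      by (rule eq_commute)
    also have "\<dots> = (\<phi> a \<otimes> \<psi> x = b \<otimes> inv c)"
      by (rule inv_solve_right[symmetric]) (simp_all add: cl ab assms(3))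
    also have "\<dots> = (b \<otimes> inv c = \<phi> a \<otimes> \<psi> x)"
      by (rule eq_commute)
    also have "\<dots> = (\<psi> x = inv (\<phi> a) \<otimes> (b \<otimes> inv c))"
      by (rule inv_solve_left[symmetric]) (simp_all add: cl ab assms(3))
    finally show ?thesis .
  qed
  have left: "(\<phi> y \<otimes> \<psi> a \<otimes> c = b) = (\<phi> y = b \<otimes> inv c \<otimes> inv (\<psi> a))"
    if ab: "a \<in> carrier G" "b \<in> carrier G" "y \<in> carrier G" for a b y
  proof -
    have "(\<phi> y \<otimes> \<psi> a \<otimes> c = b) = (b = \<phi> y \<otimes> \<psi> a \<otimes> c)"
      by (rule eq_commute)
    also have "\<dots> = (\<phi> y \<otimes> \<psi> a = b \<otimes> inv c)"
      by (rule inv_solve_right[symmetric]) (simp_all add: cl ab assms(3))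
    also have "\<dots> = (b \<otimes> inv c = \<phi> y \<otimes> \<psi> a)"
      by (rule eq_commute)
    also have "\<dots> = (\<phi> y = b \<otimes> inv c \<otimes> inv (\<psi> a))"
      by (rule inv_solve_right[symmetric]) (simp_all add: cl ab assms(3))
    finally show ?thesis .
  qed
  have solve_right: "\<exists>!x. x \<in> carrier G \<and> \<phi> a \<otimes> \<psi> x \<otimes> c = b"
    if "a \<in> carrier G" "b \<in> carrier G" for a b
  proof -
    have "\<exists>!x. x \<in> carrier G \<and> \<psi> x = inv (\<phi> a) \<otimes> (b \<otimes> inv c)"
      by (rule ex1[OF b(2)]) (simp add: cl that assms(3))
    then show ?thesis by (simp only: right[OF that] cong: conj_cong)
  qed
  have solve_left: "\<exists>!y. y \<in> carrier G \<and> \<phi> y \<otimes> \<psi> a \<otimes> c = b"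
    if "a \<in> carrier G" "b \<in> carrier G" for a b
  proof -
    have "\<exists>!y. y \<in> carrier G \<and> \<phi> y = b \<otimes> inv c \<otimes> inv (\<psi> a)"
      by (rule ex1[OF b(1)]) (simp add: cl that assms(3))
    then show ?thesis by (simp only: left[OF that] cong: conj_cong)
  qed
  show ?thesis
    unfolding quasigroup_def affine_quasigroup_def
    by (simp only: binar.simps partial_object.simps)
      (intro conjI ballI solve_right solve_left m_closed cl assms(3))
qed

end

theory Submission
  imports Defs
begin

text \<open>
  Write the group additively for a moment. An isomorphism \<open>f\<close> satisfies
  \<open>f (\<phi>\<^sub>1 x + \<psi>\<^sub>1 y + c\<^sub>1) = \<phi>\<^sub>2 (f x) + \<psi>\<^sub>2 (f y) + c\<^sub>2\<close>. Since \<open>\<phi>\<^sub>1\<close> and \<open>\<psi>\<^sub>1\<close> are onto,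
  \<open>\<phi>\<^sub>1 x\<close> and \<open>\<psi>\<^sub>1 y + c\<^sub>1\<close> are two independent arbitrary elements \<open>a\<close> and \<open>b\<close>, so this is a
  functional equation of Pexider's form \<open>f (a + b) = P a + Q b\<close>. Such an \<open>f\<close> is a homomorphism
  followed by a translation (\<open>pexider_imp_hom\<close>), hence \<open>f x = \<gamma> (x + e)\<close> for an automorphism \<open>\<gamma>\<close>
  and an element \<open>e\<close> (\<open>affine_quasigroup_iso_imp_affine\<close>).

  For a bijection of the form \<open>x \<mapsto> \<gamma> (x + e)\<close>, both sides of the isomorphism equation are sums
  of a homomorphism in \<open>x\<close>, a homomorphism in \<open>y\<close> and a constant. Setting variables to zero, one
  sees that the three parts must agree separately (\<open>split_sum_eq_iff\<close>). The homomorphic parts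
  say that \<open>\<gamma>\<close> conjugates \<open>\<phi>\<^sub>1\<close> to \<open>\<phi>\<^sub>2\<close> and \<open>\<psi>\<^sub>1\<close> to \<open>\<psi>\<^sub>2\<close>; granted this, the constant part says
  \<open>c\<^sub>2 = \<gamma> (c\<^sub>1 + u)\<close> with \<open>u = e - \<phi>\<^sub>1 e - \<psi>\<^sub>1 e\<close>
  (\<open>affine_map_in_quasigroup_iso_iff\<close>). As \<open>e\<close> runs over the group, \<open>u\<close> runs over the image of
  \<open>1 - \<phi>\<^sub>1 - \<psi>\<^sub>1\<close>, and both directions of the equivalence follow.
\<close>

lemma auto_closed: "\<phi> \<in> auto G \<Longrightarrow> x \<in> carrier G \<Longrightarrow> \<phi> x \<in> carrier G"
  by (auto simp: auto_def hom_def)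

lemma auto_mult:
  "\<phi> \<in> auto G \<Longrightarrow> x \<in> carrier G \<Longrightarrow> y \<in> carrier G \<Longrightarrow> \<phi> (x \<otimes>\<^bsub>G\<^esub> y) = \<phi> x \<otimes>\<^bsub>G\<^esub> \<phi> y"
  by (auto simp: auto_def hom_def)

lemma (in group) group_hom_auto: "\<phi> \<in> auto G \<Longrightarrow> group_hom G G \<phi>"
  by (simp add: group_hom_def group_hom_axioms_def auto_def is_group)

text \<open>
  Equality of automorphisms reduces to equality on the carrier because automorphisms are
  extensional.
\<close>

lemma (in group) eq_conjugate_AutoGroup_iff:
  assumes "\<gamma> \<in> auto G" "\<phi> \<in> auto G" "\<phi>' \<in> auto G"
  shows "\<phi>' = \<gamma> \<otimes>\<^bsub>AutoGroup G\<^esub> \<phi> \<otimes>\<^bsub>AutoGroup G\<^esub> inv\<^bsub>AutoGroup G\<^esub> \<gamma> \<longleftrightarrow>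
    (\<forall>x \<in> carrier G. \<gamma> (\<phi> x) = \<phi>' (\<gamma> x))"
proof -
  interpret A: group "AutoGroup G" by (rule AutoGroup)
  have carr: "carrier (AutoGroup G) = auto G"
    by (simp add: AutoGroup_def)
  have mult: "\<alpha> \<otimes>\<^bsub>AutoGroup G\<^esub> \<beta> = compose (carrier G) \<alpha> \<beta>"
    if "\<alpha> \<in> auto G" "\<beta> \<in> auto G" for \<alpha> \<beta>
    using that by (simp add: AutoGroup_def BijGroup_def auto_def)
  have "\<phi>' = \<gamma> \<otimes>\<^bsub>AutoGroup G\<^esub> \<phi> \<otimes>\<^bsub>AutoGroup G\<^esub> inv\<^bsub>AutoGroup G\<^esub> \<gamma> \<longleftrightarrow>
      \<gamma> \<otimes>\<^bsub>AutoGroup G\<^esub> \<phi> = \<phi>' \<otimes>\<^bsub>AutoGroup G\<^esub> \<gamma>"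
    by (rule A.inv_solve_right) (simp_all add: carr assms A.m_closed[unfolded carr])
  also have "\<dots> \<longleftrightarrow> compose (carrier G) \<gamma> \<phi> = compose (carrier G) \<phi>' \<gamma>"
    by (simp add: mult assms)
  also have "\<dots> \<longleftrightarrow> (\<forall>x \<in> carrier G. \<gamma> (\<phi> x) = \<phi>' (\<gamma> x))"
    by (auto simp: compose_def fun_eq_iff restrict_def)
  finally show ?thesis .
qed

text \<open>
  Setting \<open>b = \<one>\<close> or \<open>a = \<one>\<close> expresses \<open>P\<close> and \<open>Q\<close> through \<open>f\<close>, up to the constants \<open>Q \<one>\<close> and
  \<open>P \<one>\<close>, whose product is \<open>f \<one>\<close>. Substituting back yields \<open>f (a \<otimes> b) \<otimes> f \<one> = f a \<otimes> f b\<close>.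
\<close>

lemma (in comm_group) pexider_imp_hom:
  assumes f: "f \<in> carrier G \<rightarrow> carrier G"
    and P: "P \<in> carrier G \<rightarrow> carrier G" and Q: "Q \<in> carrier G \<rightarrow> carrier G"
    and eq: "\<And>a b. a \<in> carrier G \<Longrightarrow> b \<in> carrier G \<Longrightarrow> f (a \<otimes> b) = P a \<otimes> Q b"
  shows "(\<lambda>x. f x \<otimes> inv f \<one>) \<in> hom G G"
proof (rule homI)
  have cl: "f x \<in> carrier G" "P x \<in> carrier G" "Q x \<in> carrier G" if "x \<in> carrier G" for x
    using f P Q that by auto
  show "f x \<otimes> inv f \<one> \<in> carrier G" if "x \<in> carrier G" for x
    using that by (simp add: cl)
  show "f (a \<otimes> b) \<otimes> inv f \<one> = (f a \<otimes> inv f \<one>) \<otimes> (f b \<otimes> inv f \<one>)"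
    if a: "a \<in> carrier G" and b: "b \<in> carrier G" for a b
  proof -
    have "f (a \<otimes> b) \<otimes> f \<one> = (P a \<otimes> Q b) \<otimes> (P \<one> \<otimes> Q \<one>)"
      using eq[OF a b] eq[of \<one> \<one>] by simp
    also have "\<dots> = (P a \<otimes> Q \<one>) \<otimes> (P \<one> \<otimes> Q b)"
      using a b by (simp add: cl m_ac)
    also have "\<dots> = f a \<otimes> f b"
      using eq[OF a one_closed] eq[OF one_closed b] a b by simp
    finally have "f (a \<otimes> b) = f a \<otimes> f b \<otimes> inv f \<one>"
      using a b by (subst inv_solve_right) (simp_all add: cl)
    then show ?thesis
      using a b by (simp add: cl m_ac)
  qed
qed

lemma (in comm_group) split_sum_eq_iff:
  assumes cl: "\<And>x. x \<in> carrier G \<Longrightarrow> p x \<in> carrier G" "\<And>x. x \<in> carrier G \<Longrightarrow> q x \<in> carrier G"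
      "\<And>x. x \<in> carrier G \<Longrightarrow> p' x \<in> carrier G" "\<And>x. x \<in> carrier G \<Longrightarrow> q' x \<in> carrier G"
      "k \<in> carrier G" "k' \<in> carrier G"
    and one: "p \<one> = \<one>" "q \<one> = \<one>" "p' \<one> = \<one>" "q' \<one> = \<one>"
  shows "(\<forall>x \<in> carrier G. \<forall>y \<in> carrier G. p x \<otimes> q y \<otimes> k = p' x \<otimes> q' y \<otimes> k') \<longleftrightarrow>
    (\<forall>x \<in> carrier G. p x = p' x) \<and> (\<forall>y \<in> carrier G. q y = q' y) \<and> k = k'"
    (is "?L \<longleftrightarrow> ?R")
proof
  assume L: ?L
  have k: "k = k'"
    using L[rule_format, of \<one> \<one>] by (simp add: one cl)
  have "p x = p' x" if "x \<in> carrier G" for x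
    using L[rule_format, OF that one_closed] that by (simp add: one cl k)
  moreover have "q y = q' y" if "y \<in> carrier G" for y
    using L[rule_format, OF one_closed that] that by (simp add: one cl k)
  ultimately show ?R
    using k by blast
qed simp

lemma (in comm_group) translate_bij_betw:
  assumes "e \<in> carrier G"
  shows "bij_betw (\<lambda>x. x \<otimes> e) (carrier G) (carrier G)"
  by (rule bij_betw_byWitness[where f' = "\<lambda>x. x \<otimes> inv e"]) (use assms in \<open>auto simp: m_assoc\<close>)

text \<open>
  With \<open>d = \<gamma> e\<close>, the constant parts of the two sides of the isomorphism equation are
  \<open>\<gamma> c\<^sub>1 \<otimes> d\<close> and \<open>\<phi>\<^sub>2 d \<otimes> \<psi>\<^sub>2 d \<otimes> c\<^sub>2\<close>. The commutation relations turn \<open>\<phi>\<^sub>2 d\<close> and \<open>\<psi>\<^sub>2 d\<close> into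
  \<open>\<gamma> (\<phi>\<^sub>1 e)\<close> and \<open>\<gamma> (\<psi>\<^sub>1 e)\<close>, so solving for \<open>c\<^sub>2\<close> gives the value of \<open>\<gamma>\<close> at
  \<open>c\<^sub>1 \<otimes> e \<otimes> inv \<phi>\<^sub>1 e \<otimes> inv \<psi>\<^sub>1 e\<close>.
\<close>

lemma (in comm_group) affine_map_in_quasigroup_iso_iff:
  assumes aut: "\<phi>\<^sub>1 \<in> auto G" "\<psi>\<^sub>1 \<in> auto G" "\<phi>\<^sub>2 \<in> auto G" "\<psi>\<^sub>2 \<in> auto G" "\<gamma> \<in> auto G"
    and c: "c\<^sub>1 \<in> carrier G" "c\<^sub>2 \<in> carrier G" and e: "e \<in> carrier G"
  shows "(\<lambda>x. \<gamma> (x \<otimes> e)) \<in>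
      quasigroup_iso (affine_quasigroup G \<phi>\<^sub>1 \<psi>\<^sub>1 c\<^sub>1) (affine_quasigroup G \<phi>\<^sub>2 \<psi>\<^sub>2 c\<^sub>2) \<longleftrightarrow>
    (\<forall>x \<in> carrier G. \<gamma> (\<phi>\<^sub>1 x) = \<phi>\<^sub>2 (\<gamma> x)) \<and> (\<forall>x \<in> carrier G. \<gamma> (\<psi>\<^sub>1 x) = \<psi>\<^sub>2 (\<gamma> x)) \<and>
    c\<^sub>2 = \<gamma> (c\<^sub>1 \<otimes> one_minus_minus G \<phi>\<^sub>1 \<psi>\<^sub>1 e)"
    (is "?iso \<longleftrightarrow> ?comm\<^sub>\<phi> \<and> ?comm\<^sub>\<psi> \<and> ?const")
proof -
  note cl = aut[THEN auto_closed] c e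
  note mult = aut[THEN auto_mult]
  note one = aut[THEN group_hom_auto, THEN group_hom.hom_one]
  note inv = aut[THEN group_hom_auto, THEN group_hom.hom_inv]
  have "bij_betw (\<gamma> \<circ> (\<lambda>x. x \<otimes> e)) (carrier G) (carrier G)"
    using translate_bij_betw[OF e] auto_bij_betw[OF aut(5)] by (rule bij_betw_trans)
  then have bij: "bij_betw (\<lambda>x. \<gamma> (x \<otimes> e)) (carrier G) (carrier G)"
    by (simp add: comp_def)
  let ?k = "\<gamma> c\<^sub>1 \<otimes> \<gamma> e" and ?k' = "\<phi>\<^sub>2 (\<gamma> e) \<otimes> \<psi>\<^sub>2 (\<gamma> e) \<otimes> c\<^sub>2"
  have "?iso \<longleftrightarrow> (\<forall>x \<in> carrier G. \<forall>y \<in> carrier G.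
      \<gamma> (\<phi>\<^sub>1 x \<otimes> \<psi>\<^sub>1 y \<otimes> c\<^sub>1 \<otimes> e) = \<phi>\<^sub>2 (\<gamma> (x \<otimes> e)) \<otimes> \<psi>\<^sub>2 (\<gamma> (y \<otimes> e)) \<otimes> c\<^sub>2)"
    by (simp add: quasigroup_iso_def affine_quasigroup_def bij)
  also have "\<dots> \<longleftrightarrow> (\<forall>x \<in> carrier G. \<forall>y \<in> carrier G.
      \<gamma> (\<phi>\<^sub>1 x) \<otimes> \<gamma> (\<psi>\<^sub>1 y) \<otimes> ?k = \<phi>\<^sub>2 (\<gamma> x) \<otimes> \<psi>\<^sub>2 (\<gamma> y) \<otimes> ?k')"
    by (intro ball_cong refl arg_cong2[of _ _ _ _ "(=)"]) (simp_all add: mult cl m_ac)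
  also have "\<dots> \<longleftrightarrow> ?comm\<^sub>\<phi> \<and> ?comm\<^sub>\<psi> \<and> ?k = ?k'"
    by (rule split_sum_eq_iff) (simp_all add: cl one)
  also have "\<dots> \<longleftrightarrow> ?comm\<^sub>\<phi> \<and> ?comm\<^sub>\<psi> \<and> ?const"
  proof (intro conj_cong refl)
    assume comm: ?comm\<^sub>\<phi> ?comm\<^sub>\<psi>
    have k': "?k' = c\<^sub>2 \<otimes> (\<gamma> (\<phi>\<^sub>1 e) \<otimes> \<gamma> (\<psi>\<^sub>1 e))"
      using comm e by (simp add: cl m_ac)
    have "\<gamma> (c\<^sub>1 \<otimes> one_minus_minus G \<phi>\<^sub>1 \<psi>\<^sub>1 e) = ?k \<otimes> inv (\<gamma> (\<phi>\<^sub>1 e) \<otimes> \<gamma> (\<psi>\<^sub>1 e))"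
      by (simp add: one_minus_minus_def mult inv cl inv_mult m_assoc)
    then have "?const \<longleftrightarrow> c\<^sub>2 = ?k \<otimes> inv (\<gamma> (\<phi>\<^sub>1 e) \<otimes> \<gamma> (\<psi>\<^sub>1 e))"
      by simp
    also have "\<dots> \<longleftrightarrow> ?k = c\<^sub>2 \<otimes> (\<gamma> (\<phi>\<^sub>1 e) \<otimes> \<gamma> (\<psi>\<^sub>1 e))"
      by (rule inv_solve_right) (simp_all add: cl)
    finally show "?k = ?k' \<longleftrightarrow> ?const"
      unfolding k' by simp
  qed
  finally show ?thesis .
qed

lemma (in comm_group) quasigroup_iso_affine_cong:
  assumes "\<phi> \<in> auto G" "\<psi> \<in> auto G" "c \<in> carrier G"
    and "\<And>x. x \<in> carrier G \<Longrightarrow> f x = g x"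
  shows "f \<in> quasigroup_iso (affine_quasigroup G \<phi> \<psi> c) Q \<longleftrightarrow>
    g \<in> quasigroup_iso (affine_quasigroup G \<phi> \<psi> c) Q"
proof -
  have "bij_betw f (carrier G) (carrier Q) = bij_betw g (carrier G) (carrier Q)"
    by (rule bij_betw_cong) (rule assms(4))
  then show ?thesis
    using assms by (simp add: quasigroup_iso_def affine_quasigroup_def auto_closed)
qed

text \<open>
  Surjectivity of \<open>\<phi>\<^sub>1\<close> and \<open>\<psi>\<^sub>1\<close> turns the isomorphism equation into Pexider's, and \<open>e\<close> is the
  preimage of the translation \<open>f \<one>\<close> under the automorphism.
  Restricting \<open>x \<mapsto> f x \<otimes> inv f \<one>\<close> to the carrier makes it extensional, as membership in
  \<^term>\<open>auto G\<close> demands; outside the carrier nothing can be said about \<open>f\<close>, so \<open>f\<close> and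
  \<open>x \<mapsto> \<gamma> (x \<otimes> e)\<close> agree only on the carrier.
\<close>

lemma (in comm_group) affine_quasigroup_iso_imp_affine:
  assumes aut: "\<phi>\<^sub>1 \<in> auto G" "\<psi>\<^sub>1 \<in> auto G" "\<phi>\<^sub>2 \<in> auto G" "\<psi>\<^sub>2 \<in> auto G"
    and c: "c\<^sub>1 \<in> carrier G" "c\<^sub>2 \<in> carrier G"
    and iso: "f \<in> quasigroup_iso (affine_quasigroup G \<phi>\<^sub>1 \<psi>\<^sub>1 c\<^sub>1) (affine_quasigroup G \<phi>\<^sub>2 \<psi>\<^sub>2 c\<^sub>2)"
  obtains \<gamma> e where "\<gamma> \<in> auto G" "e \<in> carrier G" "\<And>x. x \<in> carrier G \<Longrightarrow> f x = \<gamma> (x \<otimes> e)"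
proof -
  have bij: "bij_betw f (carrier G) (carrier G)"
    using iso by (simp add: quasigroup_iso_def affine_quasigroup_def)
  have eq: "f (\<phi>\<^sub>1 x \<otimes> \<psi>\<^sub>1 y \<otimes> c\<^sub>1) = \<phi>\<^sub>2 (f x) \<otimes> \<psi>\<^sub>2 (f y) \<otimes> c\<^sub>2"
    if "x \<in> carrier G" "y \<in> carrier G" for x y
    using iso that by (simp add: quasigroup_iso_def affine_quasigroup_def)
  have f_cl: "f x \<in> carrier G" if "x \<in> carrier G" for x
    using bij that by (rule bij_betw_apply)
  have inv_cl: "inv_into (carrier G) \<alpha> x \<in> carrier G" "\<alpha> (inv_into (carrier G) \<alpha> x) = x"
    if "\<alpha> \<in> auto G" "x \<in> carrier G" for \<alpha> x
    using bij_betw_imp_surj_on[OF auto_bij_betw[OF that(1)]] that(2)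
    by (simp_all add: inv_into_into f_inv_into_f)
  define P where "P a = \<phi>\<^sub>2 (f (inv_into (carrier G) \<phi>\<^sub>1 a))" for a
  \<comment> \<open>\<open>Q\<close> takes in both constants: it undoes the translation by \<open>c\<^sub>1\<close> and supplies \<open>c\<^sub>2\<close>.\<close>
  define Q where "Q b = \<psi>\<^sub>2 (f (inv_into (carrier G) \<psi>\<^sub>1 (b \<otimes> inv c\<^sub>1))) \<otimes> c\<^sub>2" for b
  define h where "h = (\<lambda>x. f x \<otimes> inv f \<one>)"
  have "h \<in> hom G G"
    unfolding h_def
  proof (rule pexider_imp_hom)
    show "f \<in> carrier G \<rightarrow> carrier G"
      using f_cl by blast
    show "P \<in> carrier G \<rightarrow> carrier G" "Q \<in> carrier G \<rightarrow> carrier G"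
      by (simp_all add: P_def Q_def aut auto_closed f_cl inv_cl c)
    show "f (a \<otimes> b) = P a \<otimes> Q b" if ab: "a \<in> carrier G" "b \<in> carrier G" for a b
    proof -
      let ?x = "inv_into (carrier G) \<phi>\<^sub>1 a" and ?y = "inv_into (carrier G) \<psi>\<^sub>1 (b \<otimes> inv c\<^sub>1)"
      have xy: "?x \<in> carrier G" "?y \<in> carrier G"
        using ab by (simp_all add: inv_cl aut c)
      have "\<phi>\<^sub>1 ?x \<otimes> \<psi>\<^sub>1 ?y \<otimes> c\<^sub>1 = a \<otimes> b"
        using ab by (simp add: inv_cl aut c m_assoc)
      then show ?thesis
        using eq[OF xy] xy by (simp add: P_def Q_def m_assoc aut auto_closed f_cl c)
    qed
  qed
  define \<gamma> where "\<gamma> = restrict h (carrier G)"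
  have \<gamma>_hom: "\<gamma> \<in> hom G G"
    using \<open>h \<in> hom G G\<close> by (simp add: \<gamma>_def hom_restrict)
  have "bij_betw ((\<lambda>x. x \<otimes> inv f \<one>) \<circ> f) (carrier G) (carrier G)"
    using bij translate_bij_betw[of "inv f \<one>"] by (rule bij_betw_trans) (simp add: f_cl)
  then have "bij_betw \<gamma> (carrier G) (carrier G)"
    by (rule bij_betw_cong[THEN iffD1, rotated]) (simp add: \<gamma>_def h_def)
  with \<gamma>_hom have \<gamma>: "\<gamma> \<in> auto G"
    by (simp add: auto_def Bij_def \<gamma>_def)
  let ?e = "inv_into (carrier G) \<gamma> (f \<one>)"
  have e: "?e \<in> carrier G" "\<gamma> ?e = f \<one>"
    by (simp_all add: inv_cl \<gamma> f_cl)
  show thesis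
  proof (rule that[OF \<gamma> e(1)])
    show "f x = \<gamma> (x \<otimes> ?e)" if x: "x \<in> carrier G" for x
    proof -
      have "\<gamma> (x \<otimes> ?e) = \<gamma> x \<otimes> f \<one>"
        using auto_mult[OF \<gamma> x e(1)] e(2) by simp
      then show ?thesis
        using x by (simp add: \<gamma>_def h_def m_assoc f_cl)
    qed
  qed
qed

theorem theorem2p4:
  fixes G (structure)
  assumes "comm_group G"
    and "\<phi>\<^sub>1 \<in> auto G" "\<psi>\<^sub>1 \<in> auto G" "\<phi>\<^sub>2 \<in> auto G" "\<psi>\<^sub>2 \<in> auto G"
    and "c\<^sub>1 \<in> carrier G" "c\<^sub>2 \<in> carrier G"
  shows "isomorphic_quasigroups (affine_quasigroup G \<phi>\<^sub>1 \<psi>\<^sub>1 c\<^sub>1) (affine_quasigroup G \<phi>\<^sub>2 \<psi>\<^sub>2 c\<^sub>2) \<longleftrightarrow>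
    (\<exists>\<gamma> \<in> auto G. \<exists>u \<in> one_minus_minus G \<phi>\<^sub>1 \<psi>\<^sub>1 ` carrier G.
       \<phi>\<^sub>2 = \<gamma> \<otimes>\<^bsub>AutoGroup G\<^esub> \<phi>\<^sub>1 \<otimes>\<^bsub>AutoGroup G\<^esub> inv\<^bsub>AutoGroup G\<^esub> \<gamma> \<and>
       \<psi>\<^sub>2 = \<gamma> \<otimes>\<^bsub>AutoGroup G\<^esub> \<psi>\<^sub>1 \<otimes>\<^bsub>AutoGroup G\<^esub> inv\<^bsub>AutoGroup G\<^esub> \<gamma> \<and>
       c\<^sub>2 = \<gamma> (c\<^sub>1 \<otimes> u))"
proof -
  interpret comm_group G by fact
  note iff = affine_map_in_quasigroup_iso_iff[OF assms(2-5) _ assms(6,7)]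
  let ?Q\<^sub>1 = "affine_quasigroup G \<phi>\<^sub>1 \<psi>\<^sub>1 c\<^sub>1" and ?Q\<^sub>2 = "affine_quasigroup G \<phi>\<^sub>2 \<psi>\<^sub>2 c\<^sub>2"
  have "isomorphic_quasigroups ?Q\<^sub>1 ?Q\<^sub>2 \<longleftrightarrow>
      (\<exists>\<gamma> \<in> auto G. \<exists>e \<in> carrier G. (\<lambda>x. \<gamma> (x \<otimes> e)) \<in> quasigroup_iso ?Q\<^sub>1 ?Q\<^sub>2)"
  proof
    assume "isomorphic_quasigroups ?Q\<^sub>1 ?Q\<^sub>2"
    then obtain f where f: "f \<in> quasigroup_iso ?Q\<^sub>1 ?Q\<^sub>2"
      by (auto simp: isomorphic_quasigroups_def)
    show "\<exists>\<gamma> \<in> auto G. \<exists>e \<in> carrier G. (\<lambda>x. \<gamma> (x \<otimes> e)) \<in> quasigroup_iso ?Q\<^sub>1 ?Q\<^sub>2"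
    proof (rule affine_quasigroup_iso_imp_affine[OF assms(2-7) f])
      fix \<gamma> e
      assume \<gamma>: "\<gamma> \<in> auto G" "e \<in> carrier G"
        and f_eq: "\<And>x. x \<in> carrier G \<Longrightarrow> f x = \<gamma> (x \<otimes> e)"
      have "(\<lambda>x. \<gamma> (x \<otimes> e)) \<in> quasigroup_iso ?Q\<^sub>1 ?Q\<^sub>2"
        using f quasigroup_iso_affine_cong[OF assms(2,3,6), of f "\<lambda>x. \<gamma> (x \<otimes> e)" ?Q\<^sub>2] f_eq
        by simp
      with \<gamma> show "\<exists>\<gamma> \<in> auto G. \<exists>e \<in> carrier G. (\<lambda>x. \<gamma> (x \<otimes> e)) \<in> quasigroup_iso ?Q\<^sub>1 ?Q\<^sub>2"
        by blast
    qed
  qed (auto simp: isomorphic_quasigroups_def)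
  also have "\<dots> \<longleftrightarrow> (\<exists>\<gamma> \<in> auto G. \<exists>e \<in> carrier G.
      (\<forall>x \<in> carrier G. \<gamma> (\<phi>\<^sub>1 x) = \<phi>\<^sub>2 (\<gamma> x)) \<and> (\<forall>x \<in> carrier G. \<gamma> (\<psi>\<^sub>1 x) = \<psi>\<^sub>2 (\<gamma> x)) \<and>
      c\<^sub>2 = \<gamma> (c\<^sub>1 \<otimes> one_minus_minus G \<phi>\<^sub>1 \<psi>\<^sub>1 e))"
    by (simp add: iff)
  finally show ?thesis
    by (simp add: eq_conjugate_AutoGroup_iff assms cong: bex_cong)
qed

end
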